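(* Let the function $T^F_\Omega$ be convex and lower semicontinuous around $\bar x$. The following assertions hold. (i) If $\bar x\in\Omega$, then $$\partial^\infty T^F_\Omega(\bar x)=N(\bar x;\Omega)\cap F^*_+.$$ (ii) If $\bar x\notin\Omega$ and $T^F_\Omega(\bar x)<\infty$, then $$\partial^\infty T^F_\Omega(\bar x)=N(\bar x;\Omega_r)\cap F^*_+\qquad\text{with } r=T^F_\Omega(\bar x).$$
   Context: $X$ is an arbitrary (real) Banach space with topological dual $X^*$ and pairing $\langle\cdot,\cdot\rangle$; $\xrightarrow{w^*}$ denotes weak$^*$ convergence of sequences in $X^*$. Standing assumptions: $\Omega\subset X$ is nonempty and closed; $F\subset X$ is nonempty, closed, bounded and convex (it is not assumed that $0\in\mathrm{int}\,F$). The minimal time function is $T^F_\Omega(x):=\inf\{t\ge 0\mid \Omega\cap(x+tF)\ne\emptyset\}\in[0,\infty]$, with $\inf\emptyset=\infty$; for $r>0$ the enlargement of $\Omega$ is $\Omega_r:=\{x\in X\mid T^F_\Omega(x)\le r\}$. (Convexity of $T^F_\Omega$ is equivalent to convexity of $\Omega$.) The positive dual cone of $F$ is $F^*_+:=\{x^*\in X^*\mid\langle x^*,v\rangle\ge0\text{ for all }v\in F\}$. For a convex set $\Theta$ and $\bar x\in\Theta$, the normal cone is $N(\bar x;\Theta)=\{x^*\in X^*\mid\langle x^*,x-\bar x\rangle\le0\text{ for all }x\in\Theta\}$. For $\varphi:X\to(-\infty,\infty]$, $\varepsilon\ge0$ and $x$ with $\varphi(x)<\infty$, $\widehat\partial_\varepsilon\varphi(x):=\{x^*\in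 X^*\mid\liminf_{u\to x}\frac{\varphi(u)-\varphi(x)-\langle x^*,u-x\rangle}{\|u-x\|}\ge-\varepsilon\}$; for convex $\varphi$ this is $\{x^*\mid\langle x^*,u-x\rangle\le\varphi(u)-\varphi(x)+\varepsilon\|u-x\|\ \forall u\in X\}$. The singular subdifferential $\partial^\infty\varphi(\bar x)$ (for $\varphi(\bar x)<\infty$) is the set of $x^*$ for which there are sequences $\varepsilon_k\downarrow0$, $\lambda_k\downarrow0$ ($\lambda_k>0$), $x_k\to\bar x$ with $\varphi(x_k)\to\varphi(\bar x)$, and $x_k^*\in\widehat\partial_{\varepsilon_k}\varphi(x_k)$ with $\lambda_kx_k^*\xrightarrow{w^*}x^*$. *)

theory Defs
  imports "HOL-Analysis.Analysis"
begin

text \<open>The dual of \<open>'a\<close> is the type \<open>'a \<Rightarrow>\<^sub>L real\<close> of bounded linear functionals. Extended-real-valued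
  functions have type \<open>'a \<Rightarrow> ereal\<close>; the notions below are meant for functions that never take
  the value \<open>-\<infinity>\<close>.\<close>

definition weak_star_tendsto ::
    "(nat \<Rightarrow> ('a::real_normed_vector \<Rightarrow>\<^sub>L real)) \<Rightarrow> ('a \<Rightarrow>\<^sub>L real) \<Rightarrow> bool" where
  "weak_star_tendsto X l \<longleftrightarrow> (\<forall>v. (\<lambda>k. blinfun_apply (X k) v) \<longlonglongrightarrow> blinfun_apply l v)"

text \<open>In \<open>ereal\<close> the infimum of the empty set is \<open>\<infinity>\<close>.\<close>

definition minimal_time :: "'a::real_normed_vector set \<Rightarrow> 'a set \<Rightarrow> 'a \<Rightarrow> ereal" where
  "minimal_time F \<Omega> x =
     Inf {ereal t | t. 0 \<le> t \<and> \<Omega> \<inter> {x + t *\<^sub>R v | v. v \<in> F} \<noteq> {}}"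

definition enlargement :: "'a::real_normed_vector set \<Rightarrow> 'a set \<Rightarrow> real \<Rightarrow> 'a set" where
  "enlargement F \<Omega> r = {x. minimal_time F \<Omega> x \<le> ereal r}"

definition positive_dual_cone :: "'a::real_normed_vector set \<Rightarrow> ('a \<Rightarrow>\<^sub>L real) set" where
  "positive_dual_cone F = {xs. \<forall>v\<in>F. 0 \<le> blinfun_apply xs v}"

text \<open>Only meaningful for convex \<open>\<Theta>\<close> and \<open>x \<in> \<Theta>\<close>.\<close>

definition normal_cone :: "'a::real_normed_vector \<Rightarrow> 'a set \<Rightarrow> ('a \<Rightarrow>\<^sub>L real) set" where
  "normal_cone x \<Theta> = {xs. \<forall>u\<in>\<Theta>. blinfun_apply xs (u - x) \<le> 0}"

text \<open>Jensen's inequality; with \<open>\<phi> > -\<infinity>\<close> the right-hand side never contains \<open>\<infinity> - \<infinity>\<close>.\<close>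

definition ereal_convex :: "('a::real_vector \<Rightarrow> ereal) \<Rightarrow> bool" where
  "ereal_convex \<phi> \<longleftrightarrow> (\<forall>x y. \<forall>t\<in>{0<..<1::real}.
     \<phi> ((1 - t) *\<^sub>R x + t *\<^sub>R y) \<le> ereal (1 - t) * \<phi> x + ereal t * \<phi> y)"

text \<open>Lower semicontinuity at every point of some neighbourhood of \<open>x\<close>.\<close>

definition lsc_around :: "'a::topological_space \<Rightarrow> ('a \<Rightarrow> ereal) \<Rightarrow> bool" where
  "lsc_around x \<phi> \<longleftrightarrow> (\<forall>\<^sub>F y in nhds x. \<phi> y \<le> Liminf (at y) \<phi>)"

text \<open>The \<open>\<epsilon>\<close>-subdifferential at a point outside the domain is taken to be empty.\<close>

definition eps_subdiff ::
    "real \<Rightarrow> ('a::real_normed_vector \<Rightarrow> ereal) \<Rightarrow> 'a \<Rightarrow> ('a \<Rightarrow>\<^sub>L real) set" where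
  "eps_subdiff \<epsilon> \<phi> x = {xs. \<bar>\<phi> x\<bar> \<noteq> \<infinity> \<and>
     ereal (- \<epsilon>) \<le> Liminf (at x)
       (\<lambda>u. (\<phi> u - \<phi> x - ereal (blinfun_apply xs (u - x))) / ereal (norm (u - x)))}"

text \<open>\<open>\<down> 0\<close> is read as monotone convergence to \<open>0\<close>; for \<open>\<epsilon>\<close> this entails \<open>\<epsilon> k \<ge> 0\<close>. The
  monotonicity is immaterial, see \<open>singular_subdiff_iff\<close>.\<close>

definition singular_subdiff ::
    "('a::real_normed_vector \<Rightarrow> ereal) \<Rightarrow> 'a \<Rightarrow> ('a \<Rightarrow>\<^sub>L real) set" where
  "singular_subdiff \<phi> x = {xs. \<bar>\<phi> x\<bar> \<noteq> \<infinity> \<and>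
     (\<exists>(\<epsilon> :: nat \<Rightarrow> real) (\<mu> :: nat \<Rightarrow> real) (y :: nat \<Rightarrow> 'a) (ys :: nat \<Rightarrow> ('a \<Rightarrow>\<^sub>L real)).
        decseq \<epsilon> \<and> \<epsilon> \<longlonglongrightarrow> 0 \<and>
        decseq \<mu> \<and> \<mu> \<longlonglongrightarrow> 0 \<and> (\<forall>k. 0 < \<mu> k) \<and>
        y \<longlonglongrightarrow> x \<and> (\<lambda>k. \<phi> (y k)) \<longlonglongrightarrow> \<phi> x \<and>
        (\<forall>k. ys k \<in> eps_subdiff (\<epsilon> k) \<phi> (y k)) \<and>
        weak_star_tendsto (\<lambda>k. \<mu> k *\<^sub>R ys k) xs)}"

lemma decseq_subseq_of_tendsto_0:
  fixes f :: "nat \<Rightarrow> real"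
  assumes lim: "f \<longlonglongrightarrow> 0" and nonneg: "\<And>k. 0 \<le> f k"
  obtains s :: "nat \<Rightarrow> nat" where "strict_mono s" "decseq (f \<circ> s)"
proof -
  obtain s :: "nat \<Rightarrow> nat" where s: "strict_mono s" "monoseq (\<lambda>n. f (s n))"
    using seq_monosub[of f] by blast
  have l: "(\<lambda>n. f (s n)) \<longlonglongrightarrow> 0"
    using LIMSEQ_subseq_LIMSEQ[OF lim s(1)] by (simp add: o_def)
  have "decseq (\<lambda>n. f (s n))"
  proof (cases "incseq (\<lambda>n. f (s n))")
    case True
    then have "f (s n) = 0" for n
      using incseq_le[OF True l, of n] nonneg[of "s n"] by linarith
    then show ?thesis by (simp add: decseq_def)
  next
    case False
    then show ?thesis using s(2) by (simp add: monoseq_iff)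
  qed
  then show ?thesis using that s(1) by (simp add: o_def)
qed

lemma singular_subdiff_iff:
  "xs \<in> singular_subdiff \<phi> x \<longleftrightarrow> \<bar>\<phi> x\<bar> \<noteq> \<infinity> \<and>
     (\<exists>\<epsilon> \<mu> y ys. (\<forall>k. 0 \<le> \<epsilon> k) \<and> \<epsilon> \<longlonglongrightarrow> 0 \<and> \<mu> \<longlonglongrightarrow> 0 \<and> (\<forall>k. 0 < \<mu> k) \<and>
        y \<longlonglongrightarrow> x \<and> (\<lambda>k. \<phi> (y k)) \<longlonglongrightarrow> \<phi> x \<and>
        (\<forall>k. ys k \<in> eps_subdiff (\<epsilon> k) \<phi> (y k)) \<and>
        weak_star_tendsto (\<lambda>k. \<mu> k *\<^sub>R ys k) xs)"
    (is "?L \<longleftrightarrow> ?R")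
proof
  assume ?L
  then show ?R
    unfolding singular_subdiff_def mem_Collect_eq
    by (elim conjE exE, intro conjI exI) (assumption | rule allI decseq_ge)+
next
  assume ?R
  then obtain \<epsilon> \<mu> y ys where *: "\<bar>\<phi> x\<bar> \<noteq> \<infinity>" "\<And>k. 0 \<le> \<epsilon> k" "\<epsilon> \<longlonglongrightarrow> 0" "\<mu> \<longlonglongrightarrow> 0" "\<And>k. 0 < \<mu> k"
      "y \<longlonglongrightarrow> x" "(\<lambda>k. \<phi> (y k)) \<longlonglongrightarrow> \<phi> x" "\<And>k. ys k \<in> eps_subdiff (\<epsilon> k) \<phi> (y k)"
      "\<And>v. (\<lambda>k. blinfun_apply (\<mu> k *\<^sub>R ys k) v) \<longlonglongrightarrow> blinfun_apply xs v"
    unfolding weak_star_tendsto_def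
    by (elim conjE exE) (rule that; (assumption | erule spec))
  obtain s where s: "strict_mono s" "decseq (\<mu> \<circ> s)"
    by (rule decseq_subseq_of_tendsto_0[OF *(4) less_imp_le[OF *(5)]])
  have e: "(\<epsilon> \<circ> s) \<longlonglongrightarrow> 0" "\<And>k. 0 \<le> (\<epsilon> \<circ> s) k"
    using LIMSEQ_subseq_LIMSEQ[OF *(3) s(1)] *(2) by auto
  obtain t where t: "strict_mono t" "decseq ((\<epsilon> \<circ> s) \<circ> t)"
    by (rule decseq_subseq_of_tendsto_0[OF e])
  define r where "r = s \<circ> t"
  have r: "strict_mono r" unfolding r_def using s(1) t(1) by (rule strict_mono_o)
  have dl: "decseq (\<lambda>k. \<mu> (r k))"
    using s(2) strict_mono_less_eq[OF t(1)] by (simp add: decseq_def r_def)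
  have de: "decseq (\<lambda>k. \<epsilon> (r k))" using t(2) by (simp add: r_def o_def)
  note sub = LIMSEQ_subseq_LIMSEQ[OF _ r, unfolded o_def]
  show ?L
    unfolding singular_subdiff_def mem_Collect_eq weak_star_tendsto_def
    by (rule conjI[OF *(1)], rule exI[of _ "\<lambda>k. \<epsilon> (r k)"], rule exI[of _ "\<lambda>k. \<mu> (r k)"],
        rule exI[of _ "\<lambda>k. y (r k)"], rule exI[of _ "\<lambda>k. ys (r k)"], intro conjI allI)
      (rule de dl *(5) *(8) sub[OF *(3)] sub[OF *(4)] sub[OF *(6)] sub[OF *(7)] sub[OF *(9)])+
qed

end

theory Submission
  imports Defs
begin

text \<open>Write \<open>T\<close> for the minimal time function. Both parts are one statement about its effective domain
  \<open>dom T\<close>: for any convex function that never takes the value \<open>-\<infinity>\<close> and is lower semicontinuous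
  around a point of its domain, the singular subdifferential at that point is the normal cone to
  the domain (\<open>singular_subdiff_convex\<close>). What is then left is elementary: \<open>dom T\<close> consists of the
  points \<open>w - t v\<close> with \<open>w \<in> \<Omega>\<close>, \<open>t \<ge> 0\<close> and \<open>v \<in> F\<close>. A functional bounded above on this set must be
  nonnegative on \<open>F\<close>, since \<open>t\<close> may be arbitrarily large; conversely, for a functional nonnegative
  on \<open>F\<close> the moves \<open>- t v\<close> never increase its value, so it is normal to \<open>dom T\<close> as soon as it is
  normal to \<open>\<Omega>\<close>. The same holds with \<open>\<Omega>\<close> replaced by any set between \<open>\<Omega>\<close> and \<open>dom T\<close>
  (\<open>normal_cone_dom_minimal_time\<close>), in particular by an enlargement of radius \<open>r \<ge> 0\<close>.

  For the inclusion of the singular subdifferential in the normal cone, convexity makes the local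
  condition defining an \<open>\<epsilon>\<close>-subgradient global; after multiplication by \<open>\<mu> k\<close>, its right-hand side
  tends to \<open>0\<close> at each point of the domain. The left-hand side pairs a weak-star convergent
  sequence with a norm convergent one, so the Banach-Steinhaus theorem gives its limit.

  For the converse, let \<open>l\<close> be normal to \<open>dom \<phi>\<close> at \<open>x\<close>. On a small ball around \<open>x\<close>, the point \<open>x\<close>
  minimises \<open>\<mu> \<phi> - l\<close> up to an error \<open>\<mu> \<eta>\<close>. Ekeland's principle gives a nearby point \<open>y\<close> that is an
  exact minimiser after adding \<open>\<eta>\<close> times the distance to \<open>y\<close>, and a Hahn-Banach argument replaces
  this distance by a functional \<open>b\<close> of norm at most \<open>\<eta>\<close>. So \<open>(l + b) / \<mu>\<close> is an exact subgradient
  at \<open>y\<close>, and \<open>\<mu>\<close> times it is within \<open>\<eta>\<close> of \<open>l\<close>. Exactness matters: Ekeland's inequality alone says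
  that \<open>l / \<mu>\<close> is an \<open>\<eta> / \<mu>\<close>-subgradient, and \<open>\<eta> / \<mu>\<close> does not tend to \<open>0\<close>.\<close>

section \<open>Linear minorants of sublinear and of convex functions\<close>

text \<open>Homogeneity is asked only as an inequality: applying it to \<open>c\<close> and to \<open>1 / c\<close> gives equality, and
  \<open>p 0 = 0\<close> follows as well.\<close>

definition sublinear :: "('a::real_vector \<Rightarrow> real) \<Rightarrow> bool" where
  "sublinear p \<longleftrightarrow> (\<forall>x y. p (x + y) \<le> p x + p y) \<and> (\<forall>c>0. \<forall>x. p (c *\<^sub>R x) \<le> c * p x)"

lemma sublinear_zero:
  assumes "sublinear p"
  shows "p 0 = 0"
proof -
  have "p (0 + 0) \<le> p 0 + p 0" using assms unfolding sublinear_def by blast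
  moreover have "p ((1/2) *\<^sub>R 0) \<le> (1/2) * p 0"
    using assms unfolding sublinear_def by (meson half_gt_zero zero_less_one)
  ultimately show ?thesis by simp
qed

lemma sublinear_scale:
  assumes "sublinear p" "c > 0"
  shows "p (c *\<^sub>R x) = c * p x"
proof (rule antisym)
  show "p (c *\<^sub>R x) \<le> c * p x" using assms unfolding sublinear_def by blast
  have "p (inverse c *\<^sub>R (c *\<^sub>R x)) \<le> inverse c * p (c *\<^sub>R x)"
    using assms positive_imp_inverse_positive unfolding sublinear_def by blast
  then show "c * p x \<le> p (c *\<^sub>R x)" using assms(2) by (simp add: field_simps)
qed

lemma sublinear_neg_le:
  assumes "sublinear p"
  shows "- p (- x) \<le> p x"
proof -
  have "p (x + - x) \<le> p x + p (- x)" using assms unfolding sublinear_def by blast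
  then show ?thesis using sublinear_zero[OF assms] by simp
qed

text \<open>The chain condition of Zorn's lemma for sublinear functions ordered downwards. The infimum is
  finite because \<open>- p (- x) \<le> - q (- x) \<le> q x\<close>; it is subadditive because two members
  of a chain have the smaller one as a common lower bound.\<close>

lemma sublinear_INF_chain:
  assumes sub: "\<And>q. q \<in> C \<Longrightarrow> sublinear q" and below: "\<And>q. q \<in> C \<Longrightarrow> q \<le> p"
    and chain: "\<And>q r. q \<in> C \<Longrightarrow> r \<in> C \<Longrightarrow> q \<le> r \<or> r \<le> q" and ne: "C \<noteq> {}"
  shows "sublinear (\<lambda>x. INF q\<in>C. q x)" and "\<And>q. q \<in> C \<Longrightarrow> (\<lambda>x. INF q\<in>C. q x) \<le> q"
proof -
  have bdd: "bdd_below ((\<lambda>q. q x) ` C)" for x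
  proof (rule bdd_belowI2)
    fix q assume q: "q \<in> C"
    have "q (- x) \<le> p (- x)" using below[OF q] by (simp add: le_fun_def)
    then show "- p (- x) \<le> q x" using sublinear_neg_le[OF sub[OF q], of x] by simp
  qed
  have lower: "(INF q\<in>C. q x) \<le> r x" if "r \<in> C" for r x
    using that by (rule cINF_lower[OF bdd])
  show "\<And>q. q \<in> C \<Longrightarrow> (\<lambda>x. INF q\<in>C. q x) \<le> q" using lower by (simp add: le_fun_def)
  show "sublinear (\<lambda>x. INF q\<in>C. q x)"
    unfolding sublinear_def
  proof (intro conjI allI impI)
    fix x y
    have "(INF q\<in>C. q (x + y)) \<le> q x + r y" if q: "q \<in> C" and r: "r \<in> C" for q r
    proof -
      from chain[OF q r] obtain m where m: "m \<in> C" "m \<le> q" "m \<le> r" using q r by auto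
      have "m (x + y) \<le> m x + m y" using sub[OF m(1)] unfolding sublinear_def by blast
      also have "\<dots> \<le> q x + r y" using m(2,3) by (simp add: le_fun_def add_mono)
      finally show ?thesis using lower[OF m(1), of "x + y"] by linarith
    qed
    then have "(INF q\<in>C. q (x + y)) - r y \<le> (INF q\<in>C. q x)" if "r \<in> C" for r
      using that ne by (intro cINF_greatest) (auto simp: algebra_simps)
    then have "(INF q\<in>C. q (x + y)) - (INF q\<in>C. q x) \<le> (INF r\<in>C. r y)"
      using ne by (intro cINF_greatest) (auto simp: algebra_simps)
    then show "(INF q\<in>C. q (x + y)) \<le> (INF q\<in>C. q x) + (INF q\<in>C. q y)" by simp
  next
    fix c :: real and x assume c: "c > 0"
    have "(INF q\<in>C. q (c *\<^sub>R x)) / c \<le> (INF q\<in>C. q x)"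
    proof (intro cINF_greatest ne)
      fix q assume q: "q \<in> C"
      have "(INF q\<in>C. q (c *\<^sub>R x)) \<le> c * q x"
        using lower[OF q, of "c *\<^sub>R x"] sublinear_scale[OF sub[OF q] c, of x] by simp
      then show "(INF q\<in>C. q (c *\<^sub>R x)) / c \<le> q x" using c by (simp add: field_simps)
    qed
    then show "(INF q\<in>C. q (c *\<^sub>R x)) \<le> c * (INF q\<in>C. q x)" using c by (simp add: field_simps)
  qed
qed

text \<open>The step that makes a minimal sublinear function additive. Since \<open>q\<close> lies below \<open>p\<close>, minimality of
  \<open>p\<close> forces \<open>q = p\<close>, and the last inequality becomes \<open>p x + p y \<le> p (x + y)\<close>.\<close>

lemma sublinear_lower_along:
  fixes p :: "'a::real_vector \<Rightarrow> real" and y :: 'a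
  assumes p: "sublinear p"
  defines "q \<equiv> \<lambda>x. INF t\<in>{0..}. p (x + t *\<^sub>R y) - t * p y"
  shows "sublinear q" and "q \<le> p" and "q x \<le> p (x + y) - p y"
proof -
  have add: "p (u + v) \<le> p u + p v" for u v using p unfolding sublinear_def by blast
  have sc: "p (t *\<^sub>R u) = t * p u" if "t \<ge> 0" for t u
    using sublinear_scale[OF p, of t u] sublinear_zero[OF p] that by (cases "t = 0") auto
  have bdd: "bdd_below ((\<lambda>t. p (x + t *\<^sub>R y) - t * p y) ` {0..})" for x
  proof (rule bdd_belowI2)
    fix t :: real assume t: "t \<in> {0..}"
    show "- p (- x) \<le> p (x + t *\<^sub>R y) - t * p y"
      using add[of "x + t *\<^sub>R y" "- x"] sc[of t y] t by simp
  qed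
  have lower: "q x \<le> p (x + t *\<^sub>R y) - t * p y" if "t \<ge> 0" for x t
    unfolding q_def using that by (intro cINF_lower[OF bdd]) auto
  show "q \<le> p" using lower[of 0] by (simp add: le_fun_def)
  show "q x \<le> p (x + y) - p y" using lower[of 1 x] by simp
  have greatest: "b \<le> q x" if "\<And>t. t \<ge> 0 \<Longrightarrow> b \<le> p (x + t *\<^sub>R y) - t * p y" for b x
    unfolding q_def using that by (intro cINF_greatest) auto
  show "sublinear q"
    unfolding sublinear_def
  proof (intro conjI allI impI)
    fix u v
    have "q (u + v) \<le> (p (u + s *\<^sub>R y) - s * p y) + (p (v + t *\<^sub>R y) - t * p y)"
      if "s \<ge> 0" "t \<ge> 0" for s t
      using lower[of "s + t" "u + v"] add[of "u + s *\<^sub>R y" "v + t *\<^sub>R y"] that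
      by (simp add: algebra_simps)
    then have "q (u + v) - (p (v + t *\<^sub>R y) - t * p y) \<le> q u" if "t \<ge> 0" for t
      using that by (intro greatest) (simp add: algebra_simps)
    then have "q (u + v) - q u \<le> q v"
      by (intro greatest) (simp add: algebra_simps)
    then show "q (u + v) \<le> q u + q v" by simp
  next
    fix c :: real and u assume c: "c > 0"
    have "q (c *\<^sub>R u) / c \<le> q u"
    proof (rule greatest)
      fix t :: real assume t: "t \<ge> 0"
      have "q (c *\<^sub>R u) \<le> p (c *\<^sub>R (u + t *\<^sub>R y)) - (c * t) * p y"
        using lower[of "c * t" "c *\<^sub>R u"] c t by (simp add: algebra_simps)
      also have "\<dots> = c * (p (u + t *\<^sub>R y) - t * p y)"
        using sc[of c "u + t *\<^sub>R y"] c by (simp add: algebra_simps)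
      finally show "q (c *\<^sub>R u) / c \<le> p (u + t *\<^sub>R y) - t * p y" using c by (simp add: field_simps)
    qed
    then show "q (c *\<^sub>R u) \<le> c * q u" using c by (simp add: field_simps)
  qed
qed

text \<open>The Hahn-Banach theorem in the form that avoids extending functionals from subspaces: a minimal
  sublinear function below \<open>p\<close> is linear.\<close>

theorem sublinear_linear_minorant:
  fixes p :: "'a::real_vector \<Rightarrow> real"
  assumes p: "sublinear p"
  obtains l where "linear l" "\<And>x. l x \<le> p x"
proof -
  define A where "A = {q. sublinear q \<and> q \<le> p}"
  have "\<exists>m\<in>A. \<forall>a\<in>A. a \<le> m \<longrightarrow> a = m"
  proof (rule predicate_Zorn[where P = "\<lambda>q r. r \<le> q"])
    show "partial_order_on A (relation_of (\<lambda>q r. r \<le> q) A)"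
      by (rule partial_order_on_relation_ofI) auto
    fix C assume C: "C \<in> Chains (relation_of (\<lambda>q r. r \<le> q) A)"
    then have CA: "C \<subseteq> A" and ch: "\<And>q r. q \<in> C \<Longrightarrow> r \<in> C \<Longrightarrow> q \<le> r \<or> r \<le> q"
      unfolding Chains_def relation_of_def by auto
    show "\<exists>u\<in>A. \<forall>a\<in>C. u \<le> a"
    proof (cases "C = {}")
      case True
      then show ?thesis using p unfolding A_def by auto
    next
      case False
      then obtain q0 where q0: "q0 \<in> C" by blast
      have subC: "\<And>q. q \<in> C \<Longrightarrow> sublinear q" "\<And>q. q \<in> C \<Longrightarrow> q \<le> p"
        using CA unfolding A_def by auto
      have inf: "sublinear (\<lambda>x. INF q\<in>C. q x)" "(\<lambda>x. INF q\<in>C. q x) \<le> q" if "q \<in> C" for q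
        using sublinear_INF_chain[of C p] subC ch False that by blast+
      show ?thesis
      proof (rule bexI[where x = "\<lambda>x. INF q\<in>C. q x"])
        show "\<forall>a\<in>C. (\<lambda>x. INF q\<in>C. q x) \<le> a" using inf(2) by blast
        show "(\<lambda>x. INF q\<in>C. q x) \<in> A"
          unfolding A_def using inf(1)[OF q0] order_trans[OF inf(2)[OF q0] subC(2)[OF q0]] by simp
      qed
    qed
  qed
  then obtain l where l: "sublinear l" "l \<le> p" and min: "\<And>q. sublinear q \<Longrightarrow> q \<le> l \<Longrightarrow> q = l"
    unfolding A_def using order_trans by blast
  have add: "l (x + y) = l x + l y" for x y
  proof -
    have "(\<lambda>x. INF t\<in>{0..}. l (x + t *\<^sub>R y) - t * l y) = l"
      by (rule min) (rule sublinear_lower_along[OF l(1)])+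
    from fun_cong[OF this, of x] have "l x \<le> l (x + y) - l y"
      using sublinear_lower_along(3)[OF l(1), where y = y and x = x] by simp
    moreover have "l (x + y) \<le> l x + l y" using l(1) unfolding sublinear_def by blast
    ultimately show ?thesis by simp
  qed
  have neg: "l (- x) = - l x" for x
    using add[of x "- x"] sublinear_zero[OF l(1)] by simp
  have "l (c *\<^sub>R x) = c * l x" for c x
  proof (cases "c > 0")
    case True
    then show ?thesis by (rule sublinear_scale[OF l(1)])
  next
    case False
    then show ?thesis
      using sublinear_scale[OF l(1), of "- c" x] neg[of "c *\<^sub>R x"] sublinear_zero[OF l(1)]
      by (cases "c = 0") auto
  qed
  then have "linear l" using add by (intro linearI) auto
  then show thesis using that l(2) by (auto simp: le_fun_def)
qed

text \<open>The exact sum rule for \<open>f + \<epsilon> \<parallel>\<cdot> - y\<parallel>\<close> at a minimiser \<open>y\<close>. The functional is obtained by dominated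
  extension from the infimal convolution of \<open>\<epsilon> \<parallel>\<cdot>\<parallel>\<close> with the positively homogeneous hull of
  \<open>h \<mapsto> f (y + h) - f y\<close>. This is a sublinear function, finite exactly because \<open>y\<close> is a minimiser, and
  it lies below both \<open>\<epsilon> \<parallel>\<cdot>\<parallel>\<close> and \<open>f (y + \<cdot>) - f y\<close>; so a linear minorant has norm at most \<open>\<epsilon>\<close> and is a
  subgradient.\<close>

theorem convex_subgradient_of_norm_perturbed_minimizer:
  fixes f :: "'a::real_normed_vector \<Rightarrow> real"
  assumes f: "convex_on D f" and y: "y \<in> D" and \<epsilon>: "\<epsilon> \<ge> 0"
    and min: "\<And>u. u \<in> D \<Longrightarrow> f y \<le> f u + \<epsilon> * norm (u - y)"
  obtains b :: "'a \<Rightarrow>\<^sub>L real"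
  where "norm b \<le> \<epsilon>" "\<And>u. u \<in> D \<Longrightarrow> f y + blinfun_apply b (u - y) \<le> f u"
proof -
  define G where "G h = {s * (f u - f y) + \<epsilon> * norm (h - s *\<^sub>R (u - y)) | s u. 0 \<le> s \<and> u \<in> D}"
    for h
  define p where "p h = Inf (G h)" for h
  have G_ge: "- \<epsilon> * norm h \<le> g" if gG: "g \<in> G h" for g h
  proof -
    obtain s u where su: "0 \<le> s" "u \<in> D" and g: "g = s * (f u - f y) + \<epsilon> * norm (h - s *\<^sub>R (u - y))"
      using gG unfolding G_def by blast
    have "- (\<epsilon> * norm (u - y)) \<le> f u - f y" using min[OF su(2)] by simp
    then have "s * (- (\<epsilon> * norm (u - y))) \<le> s * (f u - f y)" using su(1) by (rule mult_left_mono)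
    moreover have "\<epsilon> * (s * norm (u - y)) \<le> \<epsilon> * (norm h + norm (h - s *\<^sub>R (u - y)))"
      using norm_triangle_sub[of "s *\<^sub>R (u - y)" h] su(1) \<epsilon>
      by (intro mult_left_mono) (auto simp: norm_minus_commute)
    ultimately show ?thesis unfolding g by (simp add: algebra_simps)
  qed
  have lower: "p h \<le> s * (f u - f y) + \<epsilon> * norm (h - s *\<^sub>R (u - y))" if "0 \<le> s" "u \<in> D" for h s u
    unfolding p_def
  proof (rule cInf_lower)
    show "bdd_below (G h)" using G_ge by (intro bdd_belowI) auto
  qed (use that in \<open>auto simp: G_def\<close>)
  have greatest: "b \<le> p h"
    if "\<And>s u. 0 \<le> s \<Longrightarrow> u \<in> D \<Longrightarrow> b \<le> s * (f u - f y) + \<epsilon> * norm (h - s *\<^sub>R (u - y))" for b h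
    unfolding p_def
  proof (rule cInf_greatest)
    show "G h \<noteq> {}" using y unfolding G_def by force
  qed (use that in \<open>auto simp: G_def\<close>)
  have "sublinear p"
    unfolding sublinear_def
  proof (intro conjI allI impI)
    fix h k
    have "p (h + k) \<le> (s * (f u - f y) + \<epsilon> * norm (h - s *\<^sub>R (u - y)))
                    + (t * (f v - f y) + \<epsilon> * norm (k - t *\<^sub>R (v - y)))"
      if s: "0 \<le> s" and u: "u \<in> D" and t: "0 \<le> t" and v: "v \<in> D" for s u t v
    proof -
      have tri: "\<epsilon> * norm ((h - s *\<^sub>R (u - y)) + (k - t *\<^sub>R (v - y)))
          \<le> \<epsilon> * norm (h - s *\<^sub>R (u - y)) + \<epsilon> * norm (k - t *\<^sub>R (v - y))"
        using norm_triangle_ineq[of "h - s *\<^sub>R (u - y)" "k - t *\<^sub>R (v - y)"] \<epsilon>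
        by (metis distrib_left mult_left_mono)
      show ?thesis
      \<comment> \<open>Positive weights are combined at the weighted mean of the two points; the mean is undefined
          if both weights vanish.\<close>
      proof (cases "s + t = 0")
        case True
        then have "s = 0" "t = 0" using s t by auto
        then show ?thesis using lower[OF _ y, of 0 "h + k"] tri by simp
      next
        case False
        define w where "w = (s / (s + t)) *\<^sub>R u + (t / (s + t)) *\<^sub>R v"
        have st: "s + t > 0" using False s t by linarith
        have fr: "s / (s + t) + t / (s + t) = 1" using st by (simp add: add_divide_distrib[symmetric])
        have nn: "0 \<le> s / (s + t)" "0 \<le> t / (s + t)" using s t by auto
        have wD: "w \<in> D" and fw: "f w \<le> s / (s + t) * f u + t / (s + t) * f v"
          using f u v nn fr unfolding convex_on_def w_def by (blast intro: convexD)+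
        have "(s + t) * f w \<le> (s + t) * (s / (s + t) * f u + t / (s + t) * f v)"
          using fw st by (intro mult_left_mono) auto
        also have "\<dots> = s * f u + t * f v" using st by (simp add: distrib_left del: distrib_right)
        finally have fw': "(s + t) * (f w - f y) \<le> s * (f u - f y) + t * (f v - f y)"
          by (simp add: algebra_simps)
        have "(s + t) *\<^sub>R w = s *\<^sub>R u + t *\<^sub>R v"
          using st unfolding w_def by (simp add: scaleR_add_right)
        then have id: "(h + k) - (s + t) *\<^sub>R (w - y) = (h - s *\<^sub>R (u - y)) + (k - t *\<^sub>R (v - y))"
          by (simp add: algebra_simps)
        show ?thesis
          using lower[OF less_imp_le[OF st] wD, of "h + k"] fw' tri unfolding id by linarith
      qed
    qed
    then have "p (h + k) - (t * (f v - f y) + \<epsilon> * norm (k - t *\<^sub>R (v - y))) \<le> p h"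
      if "0 \<le> t" "v \<in> D" for t v
      using that by (intro greatest) (simp add: algebra_simps)
    then have "p (h + k) - p h \<le> p k" by (intro greatest) (simp add: algebra_simps)
    then show "p (h + k) \<le> p h + p k" by simp
  next
    fix c :: real and h assume c: "c > 0"
    have "p (c *\<^sub>R h) / c \<le> p h"
    proof (rule greatest)
      fix s :: real and u assume su: "0 \<le> s" "u \<in> D"
      have "norm (c *\<^sub>R h - (c * s) *\<^sub>R (u - y)) = c * norm (h - s *\<^sub>R (u - y))"
        using c by (metis abs_of_pos norm_scaleR scaleR_right_diff_distrib scaleR_scaleR)
      then have "p (c *\<^sub>R h) \<le> c * (s * (f u - f y) + \<epsilon> * norm (h - s *\<^sub>R (u - y)))"
        using lower[of "c * s" u "c *\<^sub>R h"] c su by (simp add: algebra_simps)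
      then show "p (c *\<^sub>R h) / c \<le> s * (f u - f y) + \<epsilon> * norm (h - s *\<^sub>R (u - y))"
        using c by (simp add: field_simps)
    qed
    then show "p (c *\<^sub>R h) \<le> c * p h" using c by (simp add: field_simps)
  qed
  then obtain l where l: "linear l" "\<And>h. l h \<le> p h" using sublinear_linear_minorant by blast
  have le_norm: "l h \<le> \<epsilon> * norm h" for h
    using order_trans[OF l(2) lower[OF order_refl y]] by simp
  have abs: "norm (l h) \<le> \<epsilon> * norm h" for h
    using le_norm[of h] le_norm[of "- h"] linear_neg[OF l(1), of h] by (simp add: abs_le_iff)
  then have bl: "bounded_linear l"
    using l(1) by (auto simp: linear_conv_bounded_linear mult.commute
        intro!: bounded_linear_intro[where K = \<epsilon>] linear_add[OF l(1)] linear_scale[OF l(1)])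
  show thesis
  proof (rule that[of "Blinfun l"])
    show "norm (Blinfun l) \<le> \<epsilon>"
      using abs \<epsilon> by (intro norm_blinfun_bound) (simp_all add: bounded_linear_Blinfun_apply[OF bl])
    fix u assume "u \<in> D"
    then have "l (u - y) \<le> f u - f y"
      using order_trans[OF l(2) lower[of 1 u "u - y"]] by simp
    then show "f y + blinfun_apply (Blinfun l) (u - y) \<le> f u"
      by (simp add: bounded_linear_Blinfun_apply[OF bl])
  qed
qed

section \<open>The Ekeland variational principle\<close>

text \<open>The sets \<open>A z\<close> of points that improve on \<open>z\<close> by at least \<open>\<epsilon>\<close> times the distance form a transitive
  relation. Repeatedly choosing a nearly optimal point of the current \<open>A\<close> gives a Cauchy sequence,
  whose limit can be improved by no other point. Lower semicontinuity and closedness of \<open>S\<close>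
  enter together, as closedness of the sublevel sets.\<close>

theorem Ekeland_variational_principle:
  fixes f :: "'a::complete_space \<Rightarrow> real"
  assumes closed: "\<And>c. closed {u \<in> S. f u \<le> c}" and bdd: "bdd_below (f ` S)"
    and x: "x \<in> S" and \<epsilon>: "\<epsilon> > 0"
  obtains y where "y \<in> S" "f y + \<epsilon> * dist y x \<le> f x"
    "\<And>u. u \<in> S \<Longrightarrow> f y \<le> f u + \<epsilon> * dist u y"
proof -
  define A where "A z = {u \<in> S. f u + \<epsilon> * dist u z \<le> f z}" for z
  have self: "z \<in> A z" if "z \<in> S" for z using that by (simp add: A_def)
  have trans: "w \<in> A v" if "w \<in> A z" "z \<in> A v" for w z v
  proof -
    have "\<epsilon> * dist w v \<le> \<epsilon> * dist w z + \<epsilon> * dist z v"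
      using dist_triangle[of w v z] \<epsilon> by (metis distrib_left mult_left_mono less_imp_le)
    then show ?thesis using that by (auto simp: A_def)
  qed
  have bddA: "bdd_below (f ` A z)" for z
    using bdd by (rule bdd_below_mono) (auto simp: A_def)
  have "\<exists>w. w \<in> A z \<and> f w < Inf (f ` A z) + (1/2) ^ n" if "z \<in> S" for z n
  proof -
    have "Inf (f ` A z) < Inf (f ` A z) + (1/2) ^ n" by simp
    then show ?thesis
      using self[OF that] cInf_less_iff[OF _ bddA, of z] by blast
  qed
  note ex = this
  define step where "step n z = (SOME w. w \<in> A z \<and> f w < Inf (f ` A z) + (1/2) ^ n)" for n z
  have step: "step n z \<in> A z" "f (step n z) < Inf (f ` A z) + (1/2) ^ n" if "z \<in> S" for n z
    unfolding step_def using someI_ex[OF ex[OF that]] by blast+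
  define X where "X = rec_nat x step"
  have X0: "X 0 = x" and XS: "X (Suc n) = step n (X n)" for n by (simp_all add: X_def)
  have XinS: "X n \<in> S" for n
    by (induction n) (use x step(1) in \<open>auto simp: X0 XS A_def\<close>)
  have XA: "X (Suc n) \<in> A (X n)" for n using step(1)[OF XinS] by (simp add: XS)
  have XAm: "X m \<in> A (X n)" if "n \<le> m" for n m
    using that by (induction m rule: dec_induct) (auto intro: self[OF XinS] trans XA)
  have dec: "decseq (\<lambda>n. f (X n))"
  proof (intro decseq_SucI)
    fix n
    have "0 \<le> \<epsilon> * dist (X (Suc n)) (X n)" using \<epsilon> by simp
    then show "f (X (Suc n)) \<le> f (X n)" using XA[of n] unfolding A_def by simp
  qed
  have "bdd_below (range (\<lambda>n. f (X n)))" using bdd XinS by (auto intro: bdd_below_mono)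
  then obtain L where L: "(\<lambda>n. f (X n)) \<longlonglongrightarrow> L" and L_le: "\<And>n. L \<le> f (X n)"
    using decseq_convergent[OF dec] by (metis bdd_below.unfold rangeI)
  have "Cauchy X"
  proof (rule metric_CauchyI)
    fix e :: real assume e: "e > 0"
    have "\<forall>\<^sub>F n in sequentially. f (X n) < L + \<epsilon> * (e / 2)"
      using L \<epsilon> e by (intro order_tendstoD(2)) auto
    then obtain N where N: "f (X N) < L + \<epsilon> * (e / 2)" by (auto simp: eventually_sequentially)
    have near: "dist (X m) (X N) < e / 2" if "m \<ge> N" for m
    proof -
      have "\<epsilon> * dist (X m) (X N) < \<epsilon> * (e / 2)" using XAm[OF that] N L_le[of m] by (auto simp: A_def)
      then show ?thesis using \<epsilon> mult_less_cancel_left_pos by blast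
    qed
    then show "\<exists>M. \<forall>m\<ge>M. \<forall>n\<ge>M. dist (X m) (X n) < e"
      by (metis dist_commute dist_triangle_half_l)
  qed
  then obtain y where y: "X \<longlonglongrightarrow> y" using Cauchy_convergent convergent_def by blast
  have sub: "y \<in> S \<and> f y \<le> c" if "\<forall>\<^sub>F n in sequentially. f (X n) \<le> c" for c
    using Lim_in_closed_set[OF closed _ _ y, of c] that XinS
    by (auto simp: eventually_mono)
  have yA: "y \<in> A (X n)" for n
  proof -
    have "f y + \<epsilon> * dist y (X n) \<le> f (X n) + \<eta>" if "\<eta> > 0" for \<eta>
    proof -
      have "(\<lambda>m. f (X n) - \<epsilon> * dist (X m) (X n)) \<longlonglongrightarrow> f (X n) - \<epsilon> * dist y (X n)"
        by (intro tendsto_intros y)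
      then have "\<forall>\<^sub>F m in sequentially.
          f (X n) - \<epsilon> * dist (X m) (X n) < f (X n) - \<epsilon> * dist y (X n) + \<eta>"
        using that by (intro order_tendstoD(2)) auto
      then have "\<forall>\<^sub>F m in sequentially. f (X m) \<le> f (X n) - \<epsilon> * dist y (X n) + \<eta>"
        using eventually_ge_at_top[of n]
      proof eventually_elim
        case (elim m)
        then show ?case using XAm[of n m] by (auto simp: A_def)
      qed
      then show ?thesis using sub by fastforce
    qed
    moreover have "y \<in> S"
      using sub[of "f x"] decseqD[OF dec, of 0] X0 by simp
    ultimately show ?thesis unfolding A_def by (auto intro: field_le_epsilon)
  qed
  have yL: "f y \<le> L"
  proof (rule LIMSEQ_le_const[OF L])
    have "f y \<le> f (X n)" for n
    proof -
      have "0 \<le> \<epsilon> * dist y (X n)" using \<epsilon> by simp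
      then show ?thesis using yA[of n] unfolding A_def by simp
    qed
    then show "\<exists>N. \<forall>n\<ge>N. f y \<le> f (X n)" by blast
  qed
  show thesis
  proof (rule that)
    show "y \<in> S" "f y + \<epsilon> * dist y x \<le> f x" using yA[of 0] by (auto simp: A_def X0)
    fix u assume u: "u \<in> S"
    show "f y \<le> f u + \<epsilon> * dist u y"
    proof (rule ccontr)
      assume "\<not> ?thesis"
      then have less: "f u + \<epsilon> * dist u y < f y" by simp
      then have "u \<in> A y" using u by (simp add: A_def)
      have "L \<le> f u"
      proof (rule LIMSEQ_le[OF LIMSEQ_Suc[OF L]])
        have "(\<lambda>n. f u + (1/2) ^ n) \<longlonglongrightarrow> f u + 0" by (intro tendsto_intros) simp_all
        then show "(\<lambda>n. f u + (1/2) ^ n) \<longlonglongrightarrow> f u" by simp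
        have "f (X (Suc n)) \<le> f u + (1/2) ^ n" for n
        proof -
          have "u \<in> A (X n)" using trans[OF \<open>u \<in> A y\<close> yA] .
          then have "Inf (f ` A (X n)) \<le> f u" by (intro cInf_lower bddA) auto
          then show ?thesis using step(2)[OF XinS[of n], of n] by (simp add: XS)
        qed
        then show "\<exists>N. \<forall>n\<ge>N. f (X (Suc n)) \<le> f u + (1/2) ^ n" by blast
      qed
      moreover have "0 \<le> \<epsilon> * dist u y" using \<epsilon> by simp
      ultimately show False using less yL by linarith
    qed
  qed
qed

section \<open>Uniform boundedness and weak-star limits\<close>

text \<open>By Baire, one of the closed sets \<open>A n\<close> of points where the sequence is bounded by \<open>n\<close> contains
  a ball; differences of points of that ball bound the operator norms.\<close>

theorem Banach_Steinhaus_sequence: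
  fixes X :: "nat \<Rightarrow> 'a::banach \<Rightarrow>\<^sub>L 'b::real_normed_vector"
  assumes pw: "\<And>v. Bseq (\<lambda>k. blinfun_apply (X k) v)"
  obtains B where "\<And>k. norm (X k) \<le> B"
proof -
  define A where "A n = {v. \<forall>k. norm (blinfun_apply (X k) v) \<le> real n}" for n
  have "closed (A n)" for n
    unfolding A_def by (intro closed_Collect_all closed_Collect_le continuous_intros)
  moreover have "(\<Union>n. A n) = UNIV"
  proof -
    have "\<exists>n. v \<in> A n" for v
    proof -
      obtain K where "\<And>k. norm (blinfun_apply (X k) v) \<le> K" using pw[of v] by (auto simp: Bseq_def)
      moreover obtain n where "K \<le> real n" using real_arch_simple by blast
      ultimately show ?thesis unfolding A_def using order_trans by blast
    qed
    then show ?thesis by blast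
  qed
  moreover have "euclidean interior_of \<Union>(range A) = {}"
    if "\<And>n. closed (A n)" "\<And>n. interior (A n) = {}"
    by (rule Baire_category_alt) (use that completely_metrizable_space_euclidean in auto)
  ultimately obtain n v0 where "v0 \<in> interior (A n)"
    by (metis UNIV_not_empty euclidean_interior_of ex_in_conv interior_UNIV)
  then obtain r where r: "r > 0" "cball v0 r \<subseteq> A n" by (meson mem_interior_cball)
  have "norm (X k) \<le> 2 * real n / r" for k
  proof (rule norm_blinfun_bound)
    show "0 \<le> 2 * real n / r" using r(1) by simp
    fix h
    show "norm (blinfun_apply (X k) h) \<le> 2 * real n / r * norm h"
    proof (cases "h = 0")
      case False
      define w where "w = (r / norm h) *\<^sub>R h"
      have "norm w = r" using False r(1) by (simp add: w_def)
      then have "v0 + w \<in> A n" "v0 \<in> A n" using r by (auto simp: dist_norm)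
      then have "norm (blinfun_apply (X k) (v0 + w) - blinfun_apply (X k) v0) \<le> real n + real n"
        unfolding A_def by (intro order_trans[OF norm_triangle_ineq4] add_mono) auto
      then have "norm (blinfun_apply (X k) w) \<le> 2 * real n" by (simp add: blinfun.add_right)
      then have "r / norm h * norm (blinfun_apply (X k) h) \<le> 2 * real n"
        using r(1) by (simp add: w_def blinfun.scaleR_right)
      then show ?thesis using False r(1) by (simp add: field_simps)
    qed simp
  qed
  then show thesis using that by blast
qed

text \<open>Weak-star convergence controls fixed arguments only. For moving arguments the norms
  of the functionals have to be bounded, which is where completeness of the space is used.\<close>

lemma weak_star_tendsto_pairing:
  fixes X :: "nat \<Rightarrow> 'a::banach \<Rightarrow>\<^sub>L real"
  assumes X: "weak_star_tendsto X l" and z: "z \<longlonglongrightarrow> x"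
  shows "(\<lambda>k. blinfun_apply (X k) (z k)) \<longlonglongrightarrow> blinfun_apply l x"
proof -
  have lim: "(\<lambda>k. blinfun_apply (X k) v) \<longlonglongrightarrow> blinfun_apply l v" for v
    using X by (simp add: weak_star_tendsto_def)
  obtain B where B: "\<And>k. norm (X k) \<le> B"
    using Banach_Steinhaus_sequence[of X] lim convergent_imp_Bseq convergentI by metis
  have "(\<lambda>k. blinfun_apply (X k) (z k - x)) \<longlonglongrightarrow> 0"
  proof (rule Lim_null_comparison)
    show "\<forall>\<^sub>F k in sequentially. norm (blinfun_apply (X k) (z k - x)) \<le> B * norm (z k - x)"
      using order_trans[OF norm_blinfun mult_right_mono[OF B norm_ge_zero]]
      by (intro always_eventually) blast
    have "(\<lambda>k. B * norm (z k - x)) \<longlonglongrightarrow> B * norm (x - x)" by (intro tendsto_intros z)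
    then show "(\<lambda>k. B * norm (z k - x)) \<longlonglongrightarrow> 0" by simp
  qed
  from tendsto_add[OF this lim[of x]] show ?thesis by (simp add: blinfun.diff_right)
qed

section \<open>Subgradients and lower semicontinuity of extended-real-valued functions\<close>

lemma ereal_convex_finite:
  assumes conv: "ereal_convex \<phi>" and bot: "\<And>u. - \<infinity> < \<phi> u"
  shows "convex_on {u. \<phi> u < \<infinity>} (\<lambda>u. real_of_ereal (\<phi> u))"
proof -
  have fin: "\<phi> u = ereal (real_of_ereal (\<phi> u))" if "\<phi> u < \<infinity>" for u
    using bot[of u] that by (cases "\<phi> u") auto
  have le: "\<phi> ((1 - t) *\<^sub>R x + t *\<^sub>R y)
      \<le> ereal ((1 - t) * real_of_ereal (\<phi> x) + t * real_of_ereal (\<phi> y))"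
    if "0 < t" "t < 1" "\<phi> x < \<infinity>" "\<phi> y < \<infinity>" for t x y
  proof -
    have "\<phi> ((1 - t) *\<^sub>R x + t *\<^sub>R y) \<le> ereal (1 - t) * \<phi> x + ereal t * \<phi> y"
      using conv that(1,2) unfolding ereal_convex_def by auto
    also have "\<dots> = ereal ((1 - t) * real_of_ereal (\<phi> x) + t * real_of_ereal (\<phi> y))"
      by (subst fin[OF that(3)], subst fin[OF that(4)]) simp
    finally show ?thesis .
  qed
  show ?thesis
  proof (rule convex_onI)
    fix t x y assume "0 < t" "t < (1::real)" "x \<in> {u. \<phi> u < \<infinity>}" "y \<in> {u. \<phi> u < \<infinity>}"
    then have "\<phi> ((1 - t) *\<^sub>R x + t *\<^sub>R y)
      \<le> ereal ((1 - t) * real_of_ereal (\<phi> x) + t * real_of_ereal (\<phi> y))"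
      using le by simp
    then show "real_of_ereal (\<phi> ((1 - t) *\<^sub>R x + t *\<^sub>R y))
      \<le> (1 - t) * real_of_ereal (\<phi> x) + t * real_of_ereal (\<phi> y)"
      using bot[of "(1 - t) *\<^sub>R x + t *\<^sub>R y"] by (cases "\<phi> ((1 - t) *\<^sub>R x + t *\<^sub>R y)") auto
  next
    show "convex {u. \<phi> u < \<infinity>}"
      unfolding convex_alt
    proof (intro ballI allI impI)
      fix x y and t :: real
      assume xy: "x \<in> {u. \<phi> u < \<infinity>}" "y \<in> {u. \<phi> u < \<infinity>}" and t: "0 \<le> t \<and> t \<le> 1"
      consider "t = 0" | "t = 1" | "0 < t" "t < 1" using t by linarith
      then show "(1 - t) *\<^sub>R x + t *\<^sub>R y \<in> {u. \<phi> u < \<infinity>}"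
      proof cases
        case 3
        then have "\<phi> ((1 - t) *\<^sub>R x + t *\<^sub>R y)
            \<le> ereal ((1 - t) * real_of_ereal (\<phi> x) + t * real_of_ereal (\<phi> y))"
          using le xy by blast
        then show ?thesis by (auto simp: less_top[symmetric])
      qed (use xy in auto)
    qed
  qed
qed

text \<open>Along the segment from \<open>x\<close> to \<open>u\<close> convexity makes the difference quotients of \<open>\<phi>\<close> increase, so the
  asymptotic inequality near \<open>x\<close> carries over to \<open>u\<close> itself.\<close>

lemma eps_subdiff_affine_minorant:
  assumes conv: "ereal_convex \<phi>" and bot: "\<And>u. - \<infinity> < \<phi> u"
    and xs: "xs \<in> eps_subdiff \<epsilon> \<phi> x" and u: "\<phi> u < \<infinity>"
  shows "blinfun_apply xs (u - x)
    \<le> real_of_ereal (\<phi> u) - real_of_ereal (\<phi> x) + \<epsilon> * norm (u - x)"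
proof (cases "u = x")
  case False
  define f where "f v = real_of_ereal (\<phi> v)" for v
  define d where "d = norm (u - x)"
  have d: "d > 0" using False by (simp add: d_def)
  have fin: "\<phi> v = ereal (f v)" if "\<phi> v < \<infinity>" for v
    using bot[of v] that by (cases "\<phi> v") (auto simp: f_def)
  have cf: "convex_on {u. \<phi> u < \<infinity>} f"
    using ereal_convex_finite[OF conv bot] by (simp add: f_def[abs_def])
  have x: "\<phi> x < \<infinity>" using xs by (cases "\<phi> x") (auto simp: eps_subdiff_def)
  have "blinfun_apply xs (u - x) \<le> f u - f x + \<epsilon> * d + e" if e: "e > 0" for e
  proof -
    define \<epsilon>' where "\<epsilon>' = \<epsilon> + e / d"
    have "ereal (- \<epsilon>') < ereal (- \<epsilon>)" using e d by (simp add: \<epsilon>'_def)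
    also have "\<dots> \<le> Liminf (at x)
        (\<lambda>u. (\<phi> u - \<phi> x - ereal (blinfun_apply xs (u - x))) / ereal (norm (u - x)))"
      using xs by (simp add: eps_subdiff_def)
    finally have "\<forall>\<^sub>F v in at x.
        ereal (- \<epsilon>') < (\<phi> v - \<phi> x - ereal (blinfun_apply xs (v - x))) / ereal (norm (v - x))"
      by (rule less_LiminfD)
    then obtain \<delta> where \<delta>: "\<delta> > 0" and near: "\<And>v. v \<noteq> x \<Longrightarrow> dist v x < \<delta> \<Longrightarrow>
        ereal (- \<epsilon>') < (\<phi> v - \<phi> x - ereal (blinfun_apply xs (v - x))) / ereal (norm (v - x))"
      unfolding eventually_at by blast
    \<comment> \<open>Small enough for the point at parameter \<open>t\<close> of the segment to lie in the \<open>\<delta>\<close>-ball.\<close>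
    define t where "t = min (1/2) (\<delta> / (2 * d))"
    have t: "0 < t" "t < 1" using \<delta> d by (auto simp: t_def)
    have "t * d \<le> \<delta> / (2 * d) * d" using d by (intro mult_right_mono) (auto simp: t_def)
    then have td: "t * d < \<delta>" using \<delta> d by simp
    define v where "v = (1 - t) *\<^sub>R x + t *\<^sub>R u"
    have vx: "v - x = t *\<^sub>R (u - x)" by (simp add: v_def algebra_simps)
    have nv: "norm (v - x) = t * d" using t by (simp add: vx d_def)
    have v: "\<phi> v < \<infinity>" and fv: "f v \<le> (1 - t) * f x + t * f u"
      using cf t x u unfolding v_def convex_on_def convex_alt by auto
    have "v \<noteq> x" using nv t d by auto
    then have "ereal (- \<epsilon>') < (\<phi> v - \<phi> x - ereal (blinfun_apply xs (v - x))) / ereal (t * d)"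
      using near[of v] nv td by (simp add: dist_norm)
    then have "- \<epsilon>' < (f v - f x - blinfun_apply xs (v - x)) / (t * d)"
      unfolding fin[OF v] fin[OF x] using t d by simp
    then have "- \<epsilon>' * (t * d) < f v - f x - t * blinfun_apply xs (u - x)"
      using t d by (simp add: pos_less_divide_eq vx blinfun.scaleR_right)
    then have "t * (- \<epsilon>' * d) < t * (f u - f x - blinfun_apply xs (u - x))"
      using fv by (simp add: algebra_simps)
    then have "- \<epsilon>' * d < f u - f x - blinfun_apply xs (u - x)"
      using t by (simp only: mult_less_cancel_left_pos)
    then show ?thesis using d by (simp add: \<epsilon>'_def algebra_simps)
  qed
  then show ?thesis unfolding f_def d_def by (rule field_le_epsilon)
qed simp

lemma eps_subdiff_0I:
  assumes x: "\<bar>\<phi> x\<bar> \<noteq> \<infinity>" and bot: "\<And>u. - \<infinity> < \<phi> u"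
    and le: "\<And>u. \<phi> u < \<infinity> \<Longrightarrow>
      real_of_ereal (\<phi> x) + blinfun_apply xs (u - x) \<le> real_of_ereal (\<phi> u)"
  shows "xs \<in> eps_subdiff 0 \<phi> x"
  unfolding eps_subdiff_def mem_Collect_eq
proof (intro conjI x Liminf_bounded)
  obtain c where c: "\<phi> x = ereal c" using x by (cases "\<phi> x") auto
  have "ereal 0 \<le> (\<phi> u - \<phi> x - ereal (blinfun_apply xs (u - x))) / ereal (norm (u - x))"
    if "u \<noteq> x" for u
  proof (cases "\<phi> u")
    case (real r)
    then show ?thesis using le[of u] c that by simp
  qed (use c bot[of u] that in auto)
  then show "\<forall>\<^sub>F u in at x. ereal (- 0)
      \<le> (\<phi> u - \<phi> x - ereal (blinfun_apply xs (u - x))) / ereal (norm (u - x))"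
    by (auto simp: eventually_at_filter)
qed

text \<open>The lower limit is taken over a punctured neighbourhood; together with the value at the centre it
  controls a full neighbourhood, as needed for sequences that may take the value \<open>y\<close>.\<close>

lemma lsc_eventually_greater:
  fixes \<phi> :: "'a::t1_space \<Rightarrow> ereal"
  assumes "\<phi> y \<le> Liminf (at y) \<phi>" and "m < \<phi> y"
  shows "\<forall>\<^sub>F v in nhds y. m < \<phi> v"
proof -
  have "\<forall>\<^sub>F v in nhds y. v \<noteq> y \<longrightarrow> m < \<phi> v"
    using less_LiminfD[OF less_le_trans[OF assms(2,1)]] by (simp add: eventually_at_filter)
  then show ?thesis by eventually_elim (use assms(2) in metis)
qed

lemma lsc_sequence_le:
  fixes \<phi> :: "'a::t1_space \<Rightarrow> ereal" and r :: "nat \<Rightarrow> real"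
  assumes lsc: "\<phi> y \<le> Liminf (at y) \<phi>" and z: "z \<longlonglongrightarrow> y" and r: "r \<longlonglongrightarrow> c"
    and le: "\<And>n. \<phi> (z n) \<le> ereal (r n)"
  shows "\<phi> y \<le> ereal c"
proof (rule ccontr)
  assume "\<not> ?thesis"
  then obtain m where m: "ereal c < m" "m < \<phi> y" using dense[of "ereal c" "\<phi> y"] by (meson not_le)
  have "\<forall>\<^sub>F n in sequentially. m < \<phi> (z n)"
    using lsc_eventually_greater[OF lsc m(2)] z unfolding filterlim_iff by blast
  moreover have "\<forall>\<^sub>F n in sequentially. ereal (r n) < m"
    using order_tendstoD(2)[OF tendsto_ereal[OF r] m(1)] .
  ultimately have "\<forall>\<^sub>F n in sequentially. False"
  proof eventually_elim
    case (elim n)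
    then show ?case using less_trans[OF elim(1) le_less_trans[OF le elim(2)]] by simp
  qed
  then show False by simp
qed

section \<open>The singular subdifferential of a convex function\<close>

text \<open>At a point \<open>u\<close> where \<open>\<phi>\<close> is finite, the subgradient inequality at \<open>y k\<close> has a convergent right-hand
  side, so that multiplication by \<open>\<mu> k\<close> sends it to \<open>0\<close>.\<close>

lemma singular_subdiff_subset_normal_cone:
  fixes \<phi> :: "'a::banach \<Rightarrow> ereal"
  assumes conv: "ereal_convex \<phi>" and bot: "\<And>u. - \<infinity> < \<phi> u"
  shows "singular_subdiff \<phi> x \<subseteq> normal_cone x {u. \<phi> u < \<infinity>}"
proof
  fix xs assume "xs \<in> singular_subdiff \<phi> x"
  then obtain \<epsilon> \<mu> y ys where x: "\<bar>\<phi> x\<bar> \<noteq> \<infinity>" and \<epsilon>: "\<epsilon> \<longlonglongrightarrow> (0::real)" and \<mu>: "\<mu> \<longlonglongrightarrow> (0::real)"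
    and \<mu>_pos: "\<And>k. 0 < \<mu> k" and y: "y \<longlonglongrightarrow> x" and \<phi>y: "(\<lambda>k. \<phi> (y k)) \<longlonglongrightarrow> \<phi> x"
    and ys: "\<And>k. ys k \<in> eps_subdiff (\<epsilon> k) \<phi> (y k)"
    and ws: "weak_star_tendsto (\<lambda>k. \<mu> k *\<^sub>R ys k) xs"
    unfolding singular_subdiff_def mem_Collect_eq by (elim conjE exE) (rule that; (assumption | erule spec))
  have fy: "(\<lambda>k. real_of_ereal (\<phi> (y k))) \<longlonglongrightarrow> real_of_ereal (\<phi> x)"
    using \<phi>y x by (intro lim_real_of_ereal) (simp add: ereal_real')
  show "xs \<in> normal_cone x {u. \<phi> u < \<infinity>}"
    unfolding normal_cone_def
  proof (intro CollectI ballI)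
    fix u assume "u \<in> {u. \<phi> u < \<infinity>}"
    then have u: "\<phi> u < \<infinity>" by simp
    have "(\<lambda>k. blinfun_apply (\<mu> k *\<^sub>R ys k) (u - y k)) \<longlonglongrightarrow> blinfun_apply xs (u - x)"
      by (intro weak_star_tendsto_pairing[OF ws] tendsto_intros y)
    moreover have "(\<lambda>k. \<mu> k * (real_of_ereal (\<phi> u) - real_of_ereal (\<phi> (y k)) + \<epsilon> k * norm (u - y k)))
        \<longlonglongrightarrow> 0 * (real_of_ereal (\<phi> u) - real_of_ereal (\<phi> x) + 0 * norm (u - x))"
      by (intro tendsto_intros \<mu> \<epsilon> y fy)
    moreover have "blinfun_apply (\<mu> k *\<^sub>R ys k) (u - y k)
        \<le> \<mu> k * (real_of_ereal (\<phi> u) - real_of_ereal (\<phi> (y k)) + \<epsilon> k * norm (u - y k))" for k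
      using mult_left_mono[OF eps_subdiff_affine_minorant[OF conv bot ys u] less_imp_le[OF \<mu>_pos]]
      by (simp add: blinfun.scaleR_left)
    ultimately show "blinfun_apply xs (u - x) \<le> 0"
      using LIMSEQ_le by fastforce
  qed
qed

text \<open>A Bronsted-Rockafellar type approximation. Normality of \<open>xs\<close> means that \<open>xs\<close> attains its maximum
  over the domain at \<open>x\<close>, so \<open>\<mu> \<phi> - xs\<close> loses on a small ball only the amount \<open>\<mu> \<eta>\<close> that lower
  semicontinuity allows \<open>\<phi>\<close> to drop. Ekeland's principle with slope \<open>\<eta>\<close> then moves \<open>x\<close> by at most
  \<open>\<mu>\<close>, a distance that does not depend on the size of the ball; so \<open>\<mu>\<close> can be taken small enough for
  the new point to be interior to the ball, and convexity makes its minimality global.\<close>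

lemma normal_to_domain_approx_subgradient:
  fixes \<phi> :: "'a::banach \<Rightarrow> ereal"
  assumes conv: "ereal_convex \<phi>" and bot: "\<And>u. - \<infinity> < \<phi> u" and lsc: "lsc_around x \<phi>"
    and x: "\<phi> x < \<infinity>" and xs: "xs \<in> normal_cone x {u. \<phi> u < \<infinity>}" and \<eta>: "\<eta> > 0"
  obtains y ys \<mu> where "0 < \<mu>" "\<mu> \<le> \<eta>" "norm (y - x) \<le> \<eta>"
    "\<phi> y < \<infinity>" "\<bar>real_of_ereal (\<phi> y) - real_of_ereal (\<phi> x)\<bar> \<le> \<eta>"
    "ys \<in> eps_subdiff 0 \<phi> y" "norm (\<mu> *\<^sub>R ys - xs) \<le> \<eta>"
proof -
  define f where "f v = real_of_ereal (\<phi> v)" for v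
  have fin: "\<phi> v = ereal (f v)" if "\<phi> v < \<infinity>" for v
    using bot[of v] that by (cases "\<phi> v") (auto simp: f_def)
  have cf: "convex_on {u. \<phi> u < \<infinity>} f"
    using ereal_convex_finite[OF conv bot] by (simp add: f_def[abs_def])
  have xs_le: "blinfun_apply xs u \<le> blinfun_apply xs x" if "\<phi> u < \<infinity>" for u
    using xs that by (auto simp: normal_cone_def blinfun.diff_right)
  have lsc_x: "\<phi> x \<le> Liminf (at x) \<phi>" using lsc unfolding lsc_around_def by (rule eventually_nhds_x_imp_x)
  have "ereal (f x - \<eta>) < \<phi> x" using \<eta> by (simp add: fin[OF x])
  then have "\<forall>\<^sub>F v in nhds x. ereal (f x - \<eta>) < \<phi> v \<and> \<phi> v \<le> Liminf (at v) \<phi>"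
    using lsc_eventually_greater[OF lsc_x] lsc unfolding lsc_around_def by (intro eventually_conj) auto
  then obtain \<delta> where \<delta>: "\<delta> > 0"
    and near: "\<And>v. dist v x < \<delta> \<Longrightarrow> ereal (f x - \<eta>) < \<phi> v \<and> \<phi> v \<le> Liminf (at v) \<phi>"
    unfolding eventually_nhds_metric by blast
  \<comment> \<open>Ekeland's point has distance at most \<open>\<mu> \<le> \<delta> / 4\<close> from \<open>x\<close>, hence is interior to the ball of
      radius \<open>\<delta> / 2\<close>, which in turn stays inside the region controlled by \<open>near\<close>.\<close>
  define \<mu> where "\<mu> = min \<eta> (\<delta> / 4)"
  have \<mu>: "0 < \<mu>" "\<mu> \<le> \<eta>" "\<mu> \<le> \<delta> / 4" using \<eta> \<delta> by (auto simp: \<mu>_def)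
  define S where "S = {u \<in> cball x (\<delta> / 2). \<phi> u < \<infinity>}"
  define g where "g u = \<mu> * f u - blinfun_apply xs u" for u
  have S_near: "f x - \<eta> < f u" if "u \<in> S" for u
    using near[of u] that \<delta> fin[of u] unfolding S_def by (auto simp: dist_commute)
  have g_ge: "\<mu> * (f x - \<eta>) - blinfun_apply xs x \<le> g u" if "u \<in> S" for u
    unfolding g_def
    using mult_left_mono[OF less_imp_le[OF S_near[OF that]] less_imp_le[OF \<mu>(1)]] xs_le[of u] that
    unfolding S_def by simp
  have "closed {u \<in> S. g u \<le> c}" for c
    unfolding closed_sequential_limits
  proof (intro allI impI, elim conjE)
    fix z l assume z: "\<forall>n. z n \<in> {u \<in> S. g u \<le> c}" and l: "z \<longlonglongrightarrow> l"
    have "\<forall>n. z n \<in> cball x (\<delta> / 2)" using z by (simp add: S_def)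
    then have lc: "l \<in> cball x (\<delta> / 2)" using closed_sequentially[OF closed_cball _ l] by blast
    have "\<phi> l \<le> ereal ((c + blinfun_apply xs l) / \<mu>)"
    proof (rule lsc_sequence_le[OF _ l])
      show "\<phi> l \<le> Liminf (at l) \<phi>" using near[of l] lc \<delta> by (auto simp: dist_commute)
      show "(\<lambda>n. (c + blinfun_apply xs (z n)) / \<mu>) \<longlonglongrightarrow> (c + blinfun_apply xs l) / \<mu>"
        using \<mu>(1) by (intro tendsto_intros l) simp
      fix n
      have "\<phi> (z n) < \<infinity>" "\<mu> * f (z n) \<le> c + blinfun_apply xs (z n)"
        using z by (auto simp: S_def g_def algebra_simps)
      then show "\<phi> (z n) \<le> ereal ((c + blinfun_apply xs (z n)) / \<mu>)"
        using \<mu>(1) by (simp add: fin field_simps)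
    qed
    moreover from this have l_fin: "\<phi> l < \<infinity>" by (cases "\<phi> l") auto
    ultimately have "f l \<le> (c + blinfun_apply xs l) / \<mu>" by (simp add: fin)
    then have "g l \<le> c" using \<mu>(1) by (simp add: g_def field_simps)
    then show "l \<in> {u \<in> S. g u \<le> c}" using lc l_fin by (simp add: S_def)
  qed
  moreover have "bdd_below (g ` S)" using g_ge by (rule bdd_belowI2)
  moreover have "x \<in> S" using x \<delta> by (simp add: S_def)
  ultimately obtain y where y: "y \<in> S" and gy: "g y + \<eta> * dist y x \<le> g x"
    and min: "\<And>u. u \<in> S \<Longrightarrow> g y \<le> g u + \<eta> * dist u y"
    using Ekeland_variational_principle[of S g x \<eta>] \<eta> by metis
  have y_fin: "\<phi> y < \<infinity>" using y by (simp add: S_def)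
  have "\<eta> * dist y x \<le> \<eta> * \<mu>" using gy g_ge[OF y] by (simp add: g_def algebra_simps)
  then have dy: "dist y x \<le> \<mu>" using \<eta> by simp
  have fyx: "f y \<le> f x"
  proof -
    have "0 \<le> \<eta> * dist y x" using \<eta> by simp
    then have "\<mu> * f y \<le> \<mu> * f x" using gy xs_le[OF y_fin] by (simp add: g_def)
    then show ?thesis using \<mu>(1) by simp
  qed
  have cg: "convex_on {u. \<phi> u < \<infinity>} g"
  proof (rule convex_onI)
    show "convex {u. \<phi> u < \<infinity>}" using cf by (simp add: convex_on_def)
    fix t u v assume t: "0 < t" "t < (1::real)" and uv: "u \<in> {u. \<phi> u < \<infinity>}" "v \<in> {u. \<phi> u < \<infinity>}"
    have xs_lin: "blinfun_apply xs ((1 - t) *\<^sub>R u + t *\<^sub>R v)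
        = (1 - t) * blinfun_apply xs u + t * blinfun_apply xs v"
      by (simp only: blinfun.add_right blinfun.scaleR_right real_scaleR_def)
    have "\<mu> * f ((1 - t) *\<^sub>R u + t *\<^sub>R v) \<le> \<mu> * ((1 - t) * f u + t * f v)"
      using convex_onD[OF cf _ _ uv, of t] t \<mu>(1) by (intro mult_left_mono) auto
    then show "g ((1 - t) *\<^sub>R u + t *\<^sub>R v) \<le> (1 - t) * g u + t * g v"
      unfolding g_def xs_lin by (simp add: algebra_simps del: scaleR_left_diff_distrib scaleR_diff_left)
  qed
  have glob: "g y \<le> g u + \<eta> * norm (u - y)" if u: "\<phi> u < \<infinity>" for u
  proof -
    \<comment> \<open>A step of length at most \<open>\<mu>\<close> from \<open>y\<close> towards \<open>u\<close> does not leave the ball; adding \<open>1\<close> in the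
        denominator covers \<open>u = y\<close>.\<close>
    define t where "t = min 1 (\<mu> / (norm (u - y) + 1))"
    have n1: "0 < norm (u - y) + 1" using norm_ge_zero[of "u - y"] by linarith
    have t: "0 < t" "t \<le> 1" using \<mu>(1) n1 by (auto simp: t_def)
    have "t * norm (u - y) \<le> \<mu> / (norm (u - y) + 1) * (norm (u - y) + 1)"
      using \<mu>(1) n1 by (intro mult_mono) (auto simp: t_def)
    then have tn: "t * norm (u - y) \<le> \<mu>" using n1 by simp
    define v where "v = (1 - t) *\<^sub>R y + t *\<^sub>R u"
    have vy: "v - y = t *\<^sub>R (u - y)" by (simp add: v_def algebra_simps)
    then have dv: "dist v y = t * norm (u - y)" using t by (simp add: dist_norm)
    have "dist v x \<le> \<delta> / 2" using dist_triangle[of v x y] dv tn dy \<mu>(3) by linarith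
    moreover have "\<phi> v < \<infinity>"
      using cf t u y_fin unfolding v_def convex_on_def convex_alt by auto
    ultimately have "v \<in> S" by (simp add: S_def dist_commute)
    then have "g y \<le> g v + \<eta> * (t * norm (u - y))" using min dv by metis
    also have "g v \<le> (1 - t) * g y + t * g u"
      unfolding v_def using cg t u y_fin by (intro convex_onD) auto
    finally have "t * g y \<le> t * (g u + \<eta> * norm (u - y))" by (simp add: algebra_simps)
    then show ?thesis using t by simp
  qed
  obtain b where b: "norm b \<le> \<eta>"
      and gb: "\<And>u. u \<in> {u. \<phi> u < \<infinity>} \<Longrightarrow> g y + blinfun_apply b (u - y) \<le> g u"
    using convex_subgradient_of_norm_perturbed_minimizer[OF cg, of y \<eta>] y_fin \<eta> glob
    by (metis less_imp_le mem_Collect_eq)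
  show thesis
  proof (rule that[of \<mu> y "(1 / \<mu>) *\<^sub>R (xs + b)"])
    show "0 < \<mu>" "\<mu> \<le> \<eta>" "norm (y - x) \<le> \<eta>" using \<mu> dy by (auto simp: dist_norm)
    show "\<bar>real_of_ereal (\<phi> y) - real_of_ereal (\<phi> x)\<bar> \<le> \<eta>"
      using fyx S_near[OF y] by (simp add: f_def)
    show "norm (\<mu> *\<^sub>R (1 / \<mu>) *\<^sub>R (xs + b) - xs) \<le> \<eta>" using b \<mu>(1) by simp
    show "(1 / \<mu>) *\<^sub>R (xs + b) \<in> eps_subdiff 0 \<phi> y"
    proof (rule eps_subdiff_0I[OF _ bot])
      show "\<bar>\<phi> y\<bar> \<noteq> \<infinity>" using fin[OF y_fin] by simp
      fix u assume u: "\<phi> u < \<infinity>"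
      have "\<mu> * f y + blinfun_apply xs (u - y) + blinfun_apply b (u - y) \<le> \<mu> * f u"
        using gb[of u] u by (simp add: g_def blinfun.diff_right)
      then have "f y + (blinfun_apply xs (u - y) + blinfun_apply b (u - y)) / \<mu> \<le> f u"
        using \<mu>(1) by (simp add: field_simps)
      then show "real_of_ereal (\<phi> y) + blinfun_apply ((1 / \<mu>) *\<^sub>R (xs + b)) (u - y) \<le> real_of_ereal (\<phi> u)"
        by (simp add: f_def blinfun.scaleR_left blinfun.add_left)
    qed
  qed (rule y_fin)
qed

text \<open>The approximating subgradients for \<open>\<eta> = 1 / (k + 1)\<close> even satisfy \<open>\<epsilon> k = 0\<close> and converge, after
  scaling, in norm.\<close>

theorem singular_subdiff_convex:
  fixes \<phi> :: "'a::banach \<Rightarrow> ereal"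
  assumes conv: "ereal_convex \<phi>" and bot: "\<And>u. - \<infinity> < \<phi> u" and lsc: "lsc_around x \<phi>"
    and x: "\<phi> x < \<infinity>"
  shows "singular_subdiff \<phi> x = normal_cone x {u. \<phi> u < \<infinity>}"
proof (intro equalityI subsetI)
  fix xs assume xs: "xs \<in> normal_cone x {u. \<phi> u < \<infinity>}"
  define \<eta> where "\<eta> k = inverse (real (Suc k))" for k
  have \<eta>_lim: "\<eta> \<longlonglongrightarrow> 0" unfolding \<eta>_def by (rule LIMSEQ_inverse_real_of_nat)
  have \<eta>_pos: "0 < \<eta> k" for k by (simp add: \<eta>_def)
  define Q where "Q k = (\<lambda>(\<mu>, y, ys). 0 < \<mu> \<and> \<mu> \<le> \<eta> k \<and> norm (y - x) \<le> \<eta> k \<and> \<phi> y < \<infinity>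
      \<and> \<bar>real_of_ereal (\<phi> y) - real_of_ereal (\<phi> x)\<bar> \<le> \<eta> k
      \<and> ys \<in> eps_subdiff 0 \<phi> y \<and> norm (\<mu> *\<^sub>R ys - xs) \<le> \<eta> k)" for k
  have "\<exists>w. Q k w" for k
    by (rule normal_to_domain_approx_subgradient[OF conv bot lsc x xs \<eta>_pos[of k]])
      (auto simp: Q_def)
  then obtain w where w: "\<And>k. Q k (w k)" using choice[of Q] by blast
  define \<mu> y ys where "\<mu> k = fst (w k)" and "y k = fst (snd (w k))" and "ys k = snd (snd (w k))" for k
  have \<mu>: "0 < \<mu> k" "\<mu> k \<le> \<eta> k" and y: "norm (y k - x) \<le> \<eta> k" and y_fin: "\<phi> (y k) < \<infinity>"
    and fy: "\<bar>real_of_ereal (\<phi> (y k)) - real_of_ereal (\<phi> x)\<bar> \<le> \<eta> k"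
    and ys: "ys k \<in> eps_subdiff 0 \<phi> (y k)" and near: "norm (\<mu> k *\<^sub>R ys k - xs) \<le> \<eta> k" for k
    using w[of k] unfolding Q_def \<mu>_def y_def ys_def case_prod_beta by blast+
  have fin: "\<phi> v = ereal (real_of_ereal (\<phi> v))" if "\<phi> v < \<infinity>" for v
    using bot[of v] that by (cases "\<phi> v") auto
  note null = Lim_null_comparison[OF always_eventually \<eta>_lim]
  have "\<mu> \<longlonglongrightarrow> 0" by (rule null) (simp add: \<mu> less_imp_le)
  moreover have "y \<longlonglongrightarrow> x" by (rule LIM_zero_cancel, rule null) (use y in auto)
  moreover have "(\<lambda>k. \<phi> (y k)) \<longlonglongrightarrow> \<phi> x"
  proof -
    have "(\<lambda>k. real_of_ereal (\<phi> (y k))) \<longlonglongrightarrow> real_of_ereal (\<phi> x)"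
      by (rule LIM_zero_cancel, rule null) (use fy in auto)
    then have "(\<lambda>k. ereal (real_of_ereal (\<phi> (y k)))) \<longlonglongrightarrow> ereal (real_of_ereal (\<phi> x))"
      by (rule tendsto_ereal)
    then show ?thesis using fin[OF y_fin] fin[OF x] by simp
  qed
  moreover have "weak_star_tendsto (\<lambda>k. \<mu> k *\<^sub>R ys k) xs"
  proof -
    have "(\<lambda>k. \<mu> k *\<^sub>R ys k) \<longlonglongrightarrow> xs" by (rule LIM_zero_cancel, rule null) (use near in auto)
    then show ?thesis unfolding weak_star_tendsto_def by (intro allI tendsto_intros)
  qed
  moreover have "\<bar>\<phi> x\<bar> \<noteq> \<infinity>" using x bot[of x] by auto
  ultimately show "xs \<in> singular_subdiff \<phi> x"
    unfolding singular_subdiff_iff using \<mu>(1) ys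
    by (intro conjI exI[of _ "\<lambda>_. 0"] exI[of _ \<mu>] exI[of _ y] exI[of _ ys]) auto
qed (use singular_subdiff_subset_normal_cone[OF conv bot] in blast)

section \<open>The minimal time function\<close>

lemma minimal_time_nonneg: "0 \<le> minimal_time F \<Omega> x"
  unfolding minimal_time_def by (rule Inf_greatest) auto

lemma minimal_time_less_PInf_iff:
  "minimal_time F \<Omega> x < \<infinity> \<longleftrightarrow> (\<exists>t\<ge>0. \<exists>v\<in>F. x + t *\<^sub>R v \<in> \<Omega>)"
proof -
  have "Inf {ereal t | t. P t} < \<infinity> \<longleftrightarrow> (\<exists>t. P t)" for P
  proof
    assume "\<exists>t. P t"
    then obtain t where "P t" ..
    then have "Inf {ereal t | t. P t} \<le> ereal t" by (intro Inf_lower) auto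
    then show "Inf {ereal t | t. P t} < \<infinity>" by (rule le_less_trans) simp
  qed (unfold Inf_less_iff, blast)
  then have "minimal_time F \<Omega> x < \<infinity> \<longleftrightarrow> (\<exists>t. 0 \<le> t \<and> \<Omega> \<inter> {x + t *\<^sub>R v | v. v \<in> F} \<noteq> {})"
    unfolding minimal_time_def .
  then show ?thesis by blast
qed

lemma minimal_time_eq_0:
  assumes "x \<in> \<Omega>" "F \<noteq> {}"
  shows "minimal_time F \<Omega> x = 0"
proof (rule antisym[OF _ minimal_time_nonneg])
  show "minimal_time F \<Omega> x \<le> 0"
    unfolding minimal_time_def using assms
    by (intro Inf_lower) (auto simp: zero_ereal_def)
qed

text \<open>Going from a point of \<open>\<Omega>\<close> backwards along a direction of \<open>F\<close> never leaves the domain, so a normal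
  functional is bounded above on the whole ray, which forces its sign on \<open>F\<close>. The intermediate set
  \<open>\<Theta>\<close> stands for \<open>\<Omega>\<close> when \<open>x \<in> \<Omega>\<close>, and for the enlargement through \<open>x\<close> otherwise.\<close>

lemma normal_cone_dom_minimal_time:
  assumes ne: "\<Omega> \<noteq> {}" "F \<noteq> {}" and sub: "\<Omega> \<subseteq> \<Theta>" "\<Theta> \<subseteq> {u. minimal_time F \<Omega> u < \<infinity>}"
  shows "normal_cone x {u. minimal_time F \<Omega> u < \<infinity>} = normal_cone x \<Theta> \<inter> positive_dual_cone F"
proof (intro equalityI subsetI IntI)
  fix xs assume xs: "xs \<in> normal_cone x {u. minimal_time F \<Omega> u < \<infinity>}"
  then show "xs \<in> normal_cone x \<Theta>" using sub(2) by (auto simp: normal_cone_def)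
  obtain w where w: "w \<in> \<Omega>" using ne by blast
  show "xs \<in> positive_dual_cone F"
    unfolding positive_dual_cone_def
  proof (intro CollectI ballI)
    fix v assume v: "v \<in> F"
    have ray: "blinfun_apply xs (w - x) \<le> t * blinfun_apply xs v" if "t \<ge> 0" for t
    proof -
      have "minimal_time F \<Omega> (w - t *\<^sub>R v) < \<infinity>"
        unfolding minimal_time_less_PInf_iff using that v w
        by (intro exI[of _ t] conjI bexI[of _ v]) auto
      then have "blinfun_apply xs (w - t *\<^sub>R v - x) \<le> 0" using xs by (simp add: normal_cone_def)
      then show ?thesis by (simp add: blinfun.diff_right blinfun.scaleR_right)
    qed
    show "0 \<le> blinfun_apply xs v"
    proof (rule ccontr)
      assume neg: "\<not> ?thesis"
      \<comment> \<open>A parameter at which \<open>ray\<close> fails, because \<open>t * xs v\<close> is below \<open>- \<bar>xs (w - x)\<bar>\<close>.\<close>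
      define t where "t = (\<bar>blinfun_apply xs (w - x)\<bar> + 1) / (- blinfun_apply xs v)"
      have "t \<ge> 0" "t * blinfun_apply xs v = - (\<bar>blinfun_apply xs (w - x)\<bar> + 1)"
        using neg by (auto simp: t_def field_simps)
      then show False using ray[of t] by linarith
    qed
  qed
next
  fix xs assume "xs \<in> normal_cone x \<Theta> \<inter> positive_dual_cone F"
  then have N: "\<And>u. u \<in> \<Theta> \<Longrightarrow> blinfun_apply xs (u - x) \<le> 0" and P: "\<And>v. v \<in> F \<Longrightarrow> 0 \<le> blinfun_apply xs v"
    by (auto simp: normal_cone_def positive_dual_cone_def)
  show "xs \<in> normal_cone x {u. minimal_time F \<Omega> u < \<infinity>}"
    unfolding normal_cone_def
  proof (intro CollectI ballI)
    fix u assume "u \<in> {u. minimal_time F \<Omega> u < \<infinity>}"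
    then obtain t v where tv: "t \<ge> 0" "v \<in> F" "u + t *\<^sub>R v \<in> \<Omega>"
      unfolding mem_Collect_eq minimal_time_less_PInf_iff by blast
    have "blinfun_apply xs (u + t *\<^sub>R v - x) \<le> 0" using N tv(3) sub(1) by blast
    moreover have "0 \<le> t * blinfun_apply xs v" using tv(1) P[OF tv(2)] by simp
    ultimately show "blinfun_apply xs (u - x) \<le> 0"
      by (simp add: blinfun.diff_right blinfun.add_right blinfun.scaleR_right)
  qed
qed

theorem theorem7p2:
  fixes \<Omega> F :: "'a::banach set" and xbar :: 'a
  assumes "\<Omega> \<noteq> {}" and "closed \<Omega>"
    and "F \<noteq> {}" and "closed F" and "bounded F" and "convex F"
    and "ereal_convex (minimal_time F \<Omega>)"
    and "lsc_around xbar (minimal_time F \<Omega>)"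
  shows "(xbar \<in> \<Omega> \<longrightarrow>
            singular_subdiff (minimal_time F \<Omega>) xbar
              = normal_cone xbar \<Omega> \<inter> positive_dual_cone F) \<and>
         (xbar \<notin> \<Omega> \<and> minimal_time F \<Omega> xbar < \<infinity> \<longrightarrow>
            (let r = real_of_ereal (minimal_time F \<Omega> xbar) in
               singular_subdiff (minimal_time F \<Omega>) xbar
                 = normal_cone xbar (enlargement F \<Omega> r) \<inter> positive_dual_cone F))"
proof -
  have bot: "- \<infinity> < minimal_time F \<Omega> u" for u
    by (rule less_le_trans[OF _ minimal_time_nonneg]) simp
  note zero = minimal_time_eq_0[OF _ \<open>F \<noteq> {}\<close>]
  have key: "singular_subdiff (minimal_time F \<Omega>) xbar = normal_cone xbar \<Theta> \<inter> positive_dual_cone F"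
    if "minimal_time F \<Omega> xbar < \<infinity>" "\<Omega> \<subseteq> \<Theta>" "\<Theta> \<subseteq> {u. minimal_time F \<Omega> u < \<infinity>}" for \<Theta>
    using singular_subdiff_convex[OF assms(7) bot assms(8) that(1)]
      normal_cone_dom_minimal_time[OF assms(1,3) that(2,3)] by simp
  have "\<Omega> \<subseteq> enlargement F \<Omega> r" if "0 \<le> r" for r
    using zero that by (auto simp: enlargement_def zero_ereal_def)
  moreover have "enlargement F \<Omega> r \<subseteq> {u. minimal_time F \<Omega> u < \<infinity>}" for r
    by (auto simp: enlargement_def intro: le_less_trans)
  moreover have "\<Omega> \<subseteq> {u. minimal_time F \<Omega> u < \<infinity>}" using zero by auto
  moreover have "0 \<le> real_of_ereal (minimal_time F \<Omega> xbar)"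
    using minimal_time_nonneg by (rule real_of_ereal_pos)
  ultimately show ?thesis using key unfolding Let_def by blast
qed

end
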